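(* Let $f:\mathbb{R}^n\to\mathbb{R}$ be continuously differentiable with $\|\nabla f(x)-\nabla f(y)\|\le L\|x-y\|$ for all $x,y\in\mathbb{R}^n$, where $L>0$. Let $\{x^k\}$ be generated by sharpness-aware minimization with momentum (SAMm, see context) on $X=\mathbb{R}^n$ with $\bar\beta=\sup_k\beta_k<1$, $\bar\delta=\sup_k|\beta_k-\gamma_k|<\infty$, $\tau_1,\tau_2>0$, such that for some $\nu\in(0,1)$ $$\tau_2\le\frac{\nu}{L(\nu+1)},\qquad \max\{L\tau_1,\ 2L\tau_1\bar\delta+(L\tau_1+1)\bar\beta^2\}<1-\nu,$$ and suppose $\nabla f(x^k_{\rm ex})\ne0$ for all $k\in\mathbb{N}$. If $\inf_{k\in\mathbb{N}}f(x^k)>-\infty$, then the following hold. (i) $\nabla f(x^k)\to 0$ as $k\to\infty$. (ii) If $f$ satisfies the basic PLK condition at an accumulation point $\bar x$ of $\{x^k\}$, then $\{x^k\}$ converges to $\bar x$, and $\bar x$ is a stationary point of $f$. (iii) Assume that $f$ satisfies the PLK condition at an accumulation point $\bar x$ of $\{x^k\}$ with the desingularizing function $\psi(t)=Mt^{1-q}$, where $M>0$ and $q\in[0,1)$. Then: - if $q\in[0,1/2]$, the sequences $\{x^k\}$, $\{\nabla f(x^k)\}$, $\{f(x^k)\}$ converge linearly to $\bar x$, $0$, $f(\bar x)$, respectively; - if $q\in(1/2,1)$, then as $k\to\infty$ $$\|x^k-\bar x\|=\mathcal{O}\big(k^{-\frac{1-q}{2q-1}}\big),\quad \|\nabla f(x^k)\|=\mathcal{O}\big(k^{-\frac{1-q}{2q-1}}\big),\quad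 f(x^k)-f(\bar x)=\mathcal{O}\big(k^{-\frac{2-2q}{2q-1}}\big).$$
   Context: $\|\cdot\|$ is the Euclidean norm and $\mathbb{N}=\{1,2,\dots\}$. SAMm: choose $x^0=x^1\in X$, $\{\beta_k\},\{\gamma_k\}\subset[0,\infty)$, $\tau_1,\tau_2>0$ with $\bar\beta:=\sup_k\beta_k<1$ and $\bar\delta:=\sup_k|\beta_k-\gamma_k|<\infty$. For each $k\ge1$ put $x^k_{\rm in}:=x^k+\beta_k(x^k-x^{k-1})$, $x^k_{\rm ex}:=x^k+\gamma_k(x^k-x^{k-1})$, $x^{k+1}:=x^k_{\rm in}-\tau_1\nabla f\big(x^k_{\rm ex}+\tau_2\nabla f(x^k_{\rm ex})\big)$. PLK (Polyak-Łojasiewicz-Kurdyka) condition for a $C^1$ function $f$ at $\bar x$ with desingularizing function $\varphi$: there are $\eta\in(0,\infty]$, a neighborhood $U$ of $\bar x$ and a concave function $\varphi:[0,\eta)\to[0,\infty)$ such that $\varphi(0)=0$, $\varphi$ is $C^1$ on $(0,\eta)$, $\varphi'>0$ on $(0,\eta)$, and $\varphi'(f(x)-f(\bar x))\|\nabla f(x)\|\ge1$ for all $x\in U$ with $f(\bar x)<f(x)<f(\bar x)+\eta$. The basic PLK condition means that this holds with some $\varphi$ of this kind. A stationary point of $f$ is a point where $\nabla f$ vanishes. A sequence $\{u^k\}$ converges linearly to $u$ if $\|u^k-u\|=\mathcal{O}(\mu^k)$ for some $\mu\in(0,1)$ (R-linear convergence). *)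

theory Defs
  imports "HOL-Analysis.Analysis" "HOL-Library.Landau_Symbols"
begin

(* The gradient; unspecified at points where f is not differentiable. *)
definition grad :: "('a::real_inner \<Rightarrow> real) \<Rightarrow> 'a \<Rightarrow> 'a" where
  "grad f x = (THE D. GDERIV f x :> D)"

lemma grad_eqI:
  fixes f :: "'a::real_inner \<Rightarrow> real"
  assumes "GDERIV f x :> D"
  shows "grad f x = D"
  unfolding grad_def
proof (rule the_equality)
  show "GDERIV f x :> D" by (rule assms)
next
  fix D'
  assume "GDERIV f x :> D'"
  then have "(\<lambda>h. h \<bullet> D') = (\<lambda>h. h \<bullet> D)"
    using assms unfolding gderiv_def by (rule has_derivative_unique)
  then show "D' = D"
    by (metis vector_eq_ldot)
qed

lemma GDERIV_grad:
  fixes f :: "'a::euclidean_space \<Rightarrow> real"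
  assumes "f differentiable (at x)"
  shows "GDERIV f x :> grad f x"
proof -
  obtain F where F: "(f has_derivative F) (at x)"
    using assms by (auto simp: differentiable_def)
  then interpret F: bounded_linear F by (rule has_derivative_bounded_linear)
  have "F = (\<lambda>h. h \<bullet> adjoint F 1)"
    using adjoint_works[OF F.linear_axioms, of _ 1] by (simp add: fun_eq_iff)
  then have "GDERIV f x :> adjoint F 1"
    using F unfolding gderiv_def by metis
  then show ?thesis using grad_eqI by metis
qed

definition C1 :: "('a::real_inner \<Rightarrow> real) \<Rightarrow> bool" where
  "C1 f \<longleftrightarrow> f differentiable_on UNIV \<and> continuous_on UNIV (grad f)"

definition stationary_point :: "('a::real_inner \<Rightarrow> real) \<Rightarrow> 'a \<Rightarrow> bool" where
  "stationary_point f x \<longleftrightarrow> grad f x = 0"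

definition accumulation_point :: "(nat \<Rightarrow> 'a::topological_space) \<Rightarrow> 'a \<Rightarrow> bool" where
  "accumulation_point u l \<longleftrightarrow> (\<exists>r. strict_mono r \<and> (u \<circ> r) \<longlonglongrightarrow> l)"

definition converges_linearly :: "(nat \<Rightarrow> 'a::real_normed_vector) \<Rightarrow> 'a \<Rightarrow> bool" where
  "converges_linearly u l \<longleftrightarrow>
     (\<exists>\<mu>. 0 < \<mu> \<and> \<mu> < 1 \<and> (\<lambda>k. norm (u k - l)) \<in> O(\<lambda>k. \<mu> ^ k))"

(* Continuity of \<phi> at 0 is not required: concavity still allows an upward jump there.
   The values of \<phi> outside [0, \<eta>) are irrelevant. *)
definition desingularizing :: "ereal \<Rightarrow> (real \<Rightarrow> real) \<Rightarrow> bool" where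
  "desingularizing \<eta> \<phi> \<longleftrightarrow>
     concave_on {t. 0 \<le> t \<and> ereal t < \<eta>} \<phi> \<and>
     (\<forall>t. 0 \<le> t \<and> ereal t < \<eta> \<longrightarrow> 0 \<le> \<phi> t) \<and>
     \<phi> 0 = 0 \<and>
     \<phi> C1_differentiable_on {t. 0 < t \<and> ereal t < \<eta>} \<and>
     (\<forall>t. 0 < t \<and> ereal t < \<eta> \<longrightarrow> 0 < deriv \<phi> t)"

definition PLK_with :: "('a::real_inner \<Rightarrow> real) \<Rightarrow> 'a \<Rightarrow> (real \<Rightarrow> real) \<Rightarrow> bool" where
  "PLK_with f xbar \<phi> \<longleftrightarrow>
     (\<exists>\<eta> U. 0 < \<eta> \<and> xbar \<in> interior U \<and> desingularizing \<eta> \<phi> \<and>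
       (\<forall>x\<in>U. f xbar < f x \<and> ereal (f x) < ereal (f xbar) + \<eta> \<longrightarrow>
          deriv \<phi> (f x - f xbar) * norm (grad f x) \<ge> 1))"

definition basic_PLK :: "('a::real_inner \<Rightarrow> real) \<Rightarrow> 'a \<Rightarrow> bool" where
  "basic_PLK f xbar \<longleftrightarrow> (\<exists>\<phi>. PLK_with f xbar \<phi>)"

definition momentum_step :: "(nat \<Rightarrow> real) \<Rightarrow> (nat \<Rightarrow> 'a::real_vector) \<Rightarrow> nat \<Rightarrow> 'a" where
  "momentum_step c x k = x k + c k *\<^sub>R (x k - x (k - 1))"

(* Only the recursion; the admissibility conditions on the parameters are stated separately.
   The in-point is momentum_step \<beta> x k and the ex-point is momentum_step \<gamma> x k. *)
definition SAMm ::
  "('a::real_inner \<Rightarrow> real) \<Rightarrow> (nat \<Rightarrow> real) \<Rightarrow> (nat \<Rightarrow> real) \<Rightarrow> real \<Rightarrow> real \<Rightarrow> (nat \<Rightarrow> 'a) \<Rightarrow> bool"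
where
  "SAMm f \<beta> \<gamma> \<tau>\<^sub>1 \<tau>\<^sub>2 x \<longleftrightarrow>
     x 0 = x 1 \<and>
     (\<forall>k\<ge>1. x (Suc k) =
        momentum_step \<beta> x k -
        \<tau>\<^sub>1 *\<^sub>R grad f (momentum_step \<gamma> x k + \<tau>\<^sub>2 *\<^sub>R grad f (momentum_step \<gamma> x k)))"

end

theory Submission
  imports Defs
begin

text \<open>The perturbed gradient \<open>g\<close> used in the step satisfies \<open>norm (grad f x_ex - g) \<le> \<nu> * norm g\<close>, so
  the method is an inexact gradient method with relative error. The parameter conditions make
  \<open>H k = f (x k) + c * (norm (x k - x (k - 1)))\<^sup>2\<close> decrease by a multiple of \<open>(s k)\<^sup>2\<close>, where \<open>s k\<close> sums
  the norms of \<open>g\<close> and of two consecutive increments and dominates the gradient at \<open>x k\<close>.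
  Near an accumulation point, \<open>H k - f xbar\<close> is desingularized by a combination of \<open>\<phi> (t / 2)\<close> and
  \<open>sqrt t\<close>: either the objective gap or the velocity term makes up half of the energy. This bounds
  \<open>s k\<close> by a telescoping difference, and for power functions it turns the decrease of \<open>H\<close> into a
  recursion of the form \<open>\<kappa> * D k powr (2 * max q (1 / 2)) \<le> D k - D (Suc k)\<close>.\<close>

section \<open>Descent estimates for a Lipschitz gradient\<close>

text \<open>Along the segment, \<open>f\<close> minus its quadratic model has nonpositive
  derivative, because the gradient deviates by at most \<open>L * t * norm (b - a)\<close>.
  Monotonicity takes the place of integrating the gradient.\<close>

lemma descent_upper:
  fixes f :: "'a::euclidean_space \<Rightarrow> real"
  assumes diff: "\<And>z. GDERIV f z :> G z"
    and lip: "\<And>y z. norm (G y - G z) \<le> L * norm (y - z)"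
  shows "f b \<le> f a + (b - a) \<bullet> G a + L / 2 * (norm (b - a))\<^sup>2"
proof -
  let ?d = "b - a"
  let ?h = "\<lambda>t::real. f (a + t *\<^sub>R ?d) - t * (?d \<bullet> G a) - L / 2 * t\<^sup>2 * (norm ?d)\<^sup>2"
  have "?h 1 \<le> ?h 0"
  proof (rule DERIV_nonpos_imp_nonincreasing[of 0 1 ?h])
    fix t :: real assume t: "0 \<le> t" "t \<le> 1"
    have "((\<lambda>t. f (a + t *\<^sub>R ?d)) has_derivative (\<lambda>h. (h *\<^sub>R ?d) \<bullet> G (a + t *\<^sub>R ?d))) (at t)"
      by (rule has_derivative_compose[OF _ diff[unfolded gderiv_def]])
        (auto intro!: derivative_eq_intros)
    then have "((\<lambda>t. f (a + t *\<^sub>R ?d)) has_real_derivative (?d \<bullet> G (a + t *\<^sub>R ?d))) (at t)"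
      by (simp add: has_field_derivative_def mult.commute[of _ "_ \<bullet> _"])
    then have "(?h has_real_derivative
        (?d \<bullet> G (a + t *\<^sub>R ?d) - ?d \<bullet> G a - L * t * (norm ?d)\<^sup>2)) (at t)"
      by (auto intro!: derivative_eq_intros)
    moreover have "?d \<bullet> (G (a + t *\<^sub>R ?d) - G a) \<le> L * t * (norm ?d)\<^sup>2"
    proof -
      have "?d \<bullet> (G (a + t *\<^sub>R ?d) - G a) \<le> norm ?d * norm (G (a + t *\<^sub>R ?d) - G a)"
        by (rule norm_cauchy_schwarz)
      also have "\<dots> \<le> norm ?d * (L * (t * norm ?d))"
        using lip[of "a + t *\<^sub>R ?d" a] t by (intro mult_left_mono) auto
      finally show ?thesis by (simp add: power2_eq_square algebra_simps)
    qed
    ultimately show "\<exists>y. (?h has_real_derivative y) (at t) \<and> y \<le> 0"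
      by (auto simp: inner_diff_right)
  qed simp
  then show ?thesis by simp
qed

lemma descent_lower:
  fixes f :: "'a::euclidean_space \<Rightarrow> real"
  assumes diff: "\<And>z. GDERIV f z :> G z"
    and lip: "\<And>y z. norm (G y - G z) \<le> L * norm (y - z)"
  shows "f a + (b - a) \<bullet> G a - L / 2 * (norm (b - a))\<^sup>2 \<le> f b"
proof -
  have "GDERIV (\<lambda>z. - f z) z :> - G z" for z
    using diff by (rule GDERIV_minus)
  from descent_upper[of "\<lambda>z. - f z" "\<lambda>z. - G z" L b a, OF this]
  show ?thesis
    using lip by (simp add: norm_minus_commute)
qed

text \<open>The momentum increment \<open>b *\<^sub>R (y - p) - \<tau> *\<^sub>R g\<close> enters through the polarisation
  identity, so that the inexact gradient \<open>g\<close> contributes only squares.\<close>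

lemma inexact_momentum_step_descent:
  fixes f :: "'a::euclidean_space \<Rightarrow> real"
  assumes diff: "\<And>z. GDERIV f z :> G z"
    and lip: "\<And>y z. norm (G y - G z) \<le> L * norm (y - z)"
    and L: "0 \<le> L" and \<tau>: "0 < \<tau>" and \<nu>: "0 \<le> \<nu>"
    and z: "z = y + b *\<^sub>R (y - p) - \<tau> *\<^sub>R g"
    and err: "norm (G (y + e *\<^sub>R (y - p)) - g) \<le> \<nu> * norm g"
    and b: "0 \<le> b" "b \<le> B" and \<delta>: "\<bar>b - e\<bar> \<le> \<delta>"
  shows "2 * \<tau> * (f z - f y) + (1 - \<nu> - L * \<tau> * \<delta>) * (norm (z - y))\<^sup>2
      + (1 - \<nu> - L * \<tau>) * (\<tau> * norm g)\<^sup>2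
    \<le> ((L * \<tau> + 1) * B\<^sup>2 + L * \<tau> * \<delta>) * (norm (y - p))\<^sup>2"
proof -
  define v w where "v = y - p" and "w = z - y"
  \<comment> \<open>The momentum in-point. Expanding both \<open>f z\<close> and \<open>f y\<close>
    around it merges the gradient terms into the single product
    \<open>w \<bullet> G i\<close>.\<close>
  define i where "i = y + b *\<^sub>R v"
  have zi: "z - i = - (\<tau> *\<^sub>R g)" and yi: "y - i = - (b *\<^sub>R v)"
    by (auto simp: z i_def v_def)
  have w: "w = b *\<^sub>R v - \<tau> *\<^sub>R g"
    by (simp add: w_def z v_def)
  have "f z \<le> f i + (z - i) \<bullet> G i + L / 2 * (\<tau> * norm g)\<^sup>2"
    using descent_upper[OF diff lip, of z i] \<tau> by (simp add: zi)
  moreover have "f i + (y - i) \<bullet> G i - L / 2 * (b * norm v)\<^sup>2 \<le> f y"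
    using descent_lower[OF diff lip, of i y] b by (simp add: yi)
  moreover have "(z - i) \<bullet> G i - (y - i) \<bullet> G i = w \<bullet> G i"
    by (simp add: w_def inner_diff_left)
  ultimately have 1: "f z - f y \<le> w \<bullet> G i + L / 2 * (\<tau> * norm g)\<^sup>2 + L / 2 * (b * norm v)\<^sup>2"
    by linarith
  \<comment> \<open>Two error sources: \<open>e1\<close> is the inexactness of \<open>g\<close> at
    the ex-point, \<open>e2\<close> the gradient change between ex-point and in-point, which differ
    by \<open>(b - e) *\<^sub>R v\<close>.\<close>
  define e1 e2 where "e1 = G (y + e *\<^sub>R v) - g" and "e2 = G i - G (y + e *\<^sub>R v)"
  have split: "w \<bullet> G i = w \<bullet> g + w \<bullet> e1 + w \<bullet> e2"
    by (simp add: e1_def e2_def inner_diff_right)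
  have pol: "2 * \<tau> * (w \<bullet> g) = (b * norm v)\<^sup>2 - (norm w)\<^sup>2 - (\<tau> * norm g)\<^sup>2"
  proof -
    have "(b * norm v)\<^sup>2 = (norm (w + \<tau> *\<^sub>R g))\<^sup>2"
      using b by (simp add: w)
    also have "\<dots> = (norm w)\<^sup>2 + 2 * \<tau> * (w \<bullet> g) + (\<tau> * norm g)\<^sup>2"
      using dot_norm[of w "\<tau> *\<^sub>R g"] \<tau> by (simp add: field_simps)
    finally show ?thesis by simp
  qed
  have we1: "2 * \<tau> * (w \<bullet> e1) \<le> \<nu> * ((norm w)\<^sup>2 + (\<tau> * norm g)\<^sup>2)"
  proof -
    have "w \<bullet> e1 \<le> norm w * norm e1"
      by (rule norm_cauchy_schwarz)
    also have "\<dots> \<le> norm w * (\<nu> * norm g)"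
      using err by (intro mult_left_mono) (auto simp: e1_def v_def)
    finally have "2 * \<tau> * (w \<bullet> e1) \<le> 2 * \<tau> * (norm w * (\<nu> * norm g))"
      using \<tau> by simp
    also have "\<dots> = \<nu> * (2 * norm w * (\<tau> * norm g))" by simp
    also have "\<dots> \<le> \<nu> * ((norm w)\<^sup>2 + (\<tau> * norm g)\<^sup>2)"
      using \<nu> sum_squares_bound by (intro mult_left_mono) auto
    finally show ?thesis .
  qed
  have we2: "2 * \<tau> * (w \<bullet> e2) \<le> L * \<tau> * \<delta> * ((norm w)\<^sup>2 + (norm v)\<^sup>2)"
  proof -
    have "norm e2 \<le> L * norm ((b - e) *\<^sub>R v)"
      using lip[of i "y + e *\<^sub>R v"] by (simp add: e2_def i_def algebra_simps)
    also have "\<dots> \<le> L * (\<delta> * norm v)"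
      using \<delta> L by (auto intro!: mult_left_mono mult_right_mono)
    finally have "norm w * norm e2 \<le> norm w * (L * (\<delta> * norm v))"
      by (intro mult_left_mono) auto
    with norm_cauchy_schwarz[of w e2] have "w \<bullet> e2 \<le> norm w * (L * (\<delta> * norm v))"
      by linarith
    then have "2 * \<tau> * (w \<bullet> e2) \<le> 2 * \<tau> * (norm w * (L * (\<delta> * norm v)))"
      using \<tau> by simp
    also have "\<dots> = L * \<tau> * \<delta> * (2 * norm w * norm v)" by simp
    also have "\<dots> \<le> L * \<tau> * \<delta> * ((norm w)\<^sup>2 + (norm v)\<^sup>2)"
      using \<tau> L \<delta> sum_squares_bound by (intro mult_left_mono) auto
    finally show ?thesis .
  qed
  have "2 * \<tau> * (f z - f y)
      \<le> 2 * \<tau> * (w \<bullet> G i + L / 2 * (\<tau> * norm g)\<^sup>2 + L / 2 * (b * norm v)\<^sup>2)"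
    using 1 \<tau> by (intro mult_left_mono) auto
  also have "\<dots> = 2 * \<tau> * (w \<bullet> g) + 2 * \<tau> * (w \<bullet> e1) + 2 * \<tau> * (w \<bullet> e2)
      + L * \<tau> * (\<tau> * norm g)\<^sup>2 + L * \<tau> * (b * norm v)\<^sup>2"
    by (simp add: split algebra_simps)
  also have "\<dots> \<le> (b * norm v)\<^sup>2 - (norm w)\<^sup>2 - (\<tau> * norm g)\<^sup>2
      + \<nu> * ((norm w)\<^sup>2 + (\<tau> * norm g)\<^sup>2) + L * \<tau> * \<delta> * ((norm w)\<^sup>2 + (norm v)\<^sup>2)
      + L * \<tau> * (\<tau> * norm g)\<^sup>2 + L * \<tau> * (b * norm v)\<^sup>2"
    using pol we1 we2 by linarith
  finally have "2 * \<tau> * (f z - f y) + (1 - \<nu> - L * \<tau> * \<delta>) * (norm w)\<^sup>2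
      + (1 - \<nu> - L * \<tau>) * (\<tau> * norm g)\<^sup>2
    \<le> (L * \<tau> + 1) * (b * norm v)\<^sup>2 + L * \<tau> * \<delta> * (norm v)\<^sup>2"
    by (simp add: algebra_simps)
  also have "\<dots> \<le> (L * \<tau> + 1) * (B * norm v)\<^sup>2 + L * \<tau> * \<delta> * (norm v)\<^sup>2"
    using b L \<tau> by (intro add_right_mono mult_left_mono power_mono mult_right_mono) auto
  finally show ?thesis
    by (simp add: v_def w_def algebra_simps power_mult_distrib)
qed

section \<open>Power inequalities and decay of recursions\<close>

text \<open>Young's inequality with weights \<open>e\<close> and \<open>1 - e\<close>, multiplied by
  \<open>u powr (e - 1)\<close>.\<close>

lemma powr_concave_tangent:
  fixes u w e :: real
  assumes "0 < e" "e < 1" "0 < u" "0 < w"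
  shows "e * u powr (e - 1) * (u - w) \<le> u powr e - w powr e"
proof -
  have "w powr e * u powr (1 - e) \<le> e * w + (1 - e) * u"
    using Youngs_inequality_0[of e "1 - e" w u] assms by simp
  then have "(w powr e * u powr (1 - e)) * u powr (e - 1) \<le> (e * w + (1 - e) * u) * u powr (e - 1)"
    by (rule mult_right_mono) simp
  moreover have "u powr (1 - e) * u powr (e - 1) = 1"
    using assms by (simp flip: powr_add)
  ultimately have "w powr e \<le> (e * w + (1 - e) * u) * u powr (e - 1)"
    by (simp only: mult.assoc mult_1_right)
  also have "\<dots> = u * u powr (e - 1) - e * u powr (e - 1) * (u - w)"
    by (simp add: algebra_simps)
  also have "u * u powr (e - 1) = u powr e"
    using assms by (simp add: powr_mult_base)
  finally show ?thesis by simp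
qed

text \<open>For the ratio \<open>w / u\<close> this follows from \<open>ln y \<le> y - 1\<close> and
  \<open>1 + y \<le> exp y\<close>; scaling by \<open>u powr (- r)\<close> gives the general
  case.\<close>

lemma powr_neg_convex_tangent:
  fixes u w r :: real
  assumes "0 < r" "0 < u" "0 < w"
  shows "r * u powr (- r - 1) * (u - w) \<le> w powr (- r) - u powr (- r)"
proof -
  have "1 + r * (1 - w / u) \<le> 1 + - r * ln (w / u)"
    using mult_left_mono[OF ln_le_minus_one[of "w / u"], of r] assms
    by (simp add: algebra_simps)
  also have "\<dots> \<le> exp (- r * ln (w / u))" by (rule exp_ge_add_one_self)
  also have "\<dots> = (w / u) powr (- r)"
    using assms by (simp add: powr_def)
  finally have "(1 + r * (1 - w / u)) * u powr (- r) \<le> (w / u) powr (- r) * u powr (- r)"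
    by (rule mult_right_mono) simp
  moreover have "(w / u) powr (- r) * u powr (- r) = w powr (- r)"
    using assms by (simp add: powr_divide)
  moreover have "u powr (- r) = u * u powr (- r - 1)"
    using assms by (simp add: powr_mult_base)
  then have "(1 + r * (1 - w / u)) * u powr (- r) = u powr (- r) + r * u powr (- r - 1) * (u - w)"
    using assms by (simp add: field_simps)
  ultimately show ?thesis by simp
qed

text \<open>The substitution \<open>D k powr (- r)\<close> linearises the recursion: by the convex
  tangent inequality it grows by at least \<open>r * \<kappa>\<close> per step, and inverting the
  power turns this growth into the rate.\<close>

lemma powr_recursion_decay:
  fixes D :: "nat \<Rightarrow> real"
  assumes r: "0 < r" and \<kappa>: "0 < \<kappa>"
    and pos: "\<And>k. K \<le> k \<Longrightarrow> 0 < D k"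
    and rec: "\<And>k. K \<le> k \<Longrightarrow> \<kappa> * D k powr (r + 1) \<le> D k - D (Suc k)"
  shows "\<exists>A>0. \<forall>k\<ge>2 * K + 1. D k \<le> A * real k powr (- (1 / r))"
proof -
  have inc: "r * \<kappa> \<le> D (Suc k) powr (- r) - D k powr (- r)" if k: "K \<le> k" for k
  proof -
    have "D k powr (- r - 1) * D k powr (r + 1) = 1"
      using pos[OF k] by (simp flip: powr_add)
    then have "r * \<kappa> = r * D k powr (- r - 1) * (\<kappa> * D k powr (r + 1))" by simp
    also have "\<dots> \<le> r * D k powr (- r - 1) * (D k - D (Suc k))"
      using rec[OF k] r by (intro mult_left_mono) auto
    also have "\<dots> \<le> D (Suc k) powr (- r) - D k powr (- r)"
      using r pos k by (intro powr_neg_convex_tangent) auto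
    finally show ?thesis .
  qed
  have lower: "r * \<kappa> * real n \<le> D (K + n) powr (- r)" for n
  proof (induction n)
    case (Suc n)
    then show ?case using inc[of "K + n"] by (simp add: algebra_simps)
  qed simp
  let ?A = "(r * \<kappa> / 2) powr (- (1 / r))"
  have "D k \<le> ?A * real k powr (- (1 / r))" if k: "2 * K + 1 \<le> k" for k
  proof -
    \<comment> \<open>From \<open>2 * K + 1\<close> on, \<open>k - K\<close> is at least
      \<open>k / 2\<close>, so the start index costs only a factor.\<close>
    have "r * \<kappa> / 2 * real k \<le> r * \<kappa> * real (k - K)"
      using k r \<kappa> by (simp add: of_nat_diff)
    also have "\<dots> \<le> D k powr (- r)"
      using lower[of "k - K"] k by simp
    finally have "(D k powr (- r)) powr (- (1 / r)) \<le> (r * \<kappa> / 2 * real k) powr (- (1 / r))"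
      using r \<kappa> k by (intro powr_mono2') auto
    moreover have "(r * \<kappa> / 2 * real k) powr (- (1 / r)) = ?A * real k powr (- (1 / r))"
      using r \<kappa> by (simp only: powr_mult)
    ultimately show ?thesis
      using pos[of k] k r by (simp add: powr_powr)
  qed
  moreover have "0 < ?A" using r \<kappa> by simp
  ultimately show ?thesis by blast
qed

lemma geometric_recursion_decay:
  fixes D :: "nat \<Rightarrow> real"
  assumes "0 \<le> \<mu>" and rec: "\<And>k. K \<le> k \<Longrightarrow> D (Suc k) \<le> \<mu> * D k" and "K \<le> k"
  shows "D k \<le> D K * \<mu> ^ (k - K)"
  using \<open>K \<le> k\<close>
proof (induction k rule: dec_induct)
  case (step n)
  then have "\<mu> * D n \<le> \<mu> * (D K * \<mu> ^ (n - K))"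
    using assms(1) by (intro mult_left_mono)
  with rec[of n] step show ?case
    by (simp add: Suc_diff_le algebra_simps)
qed simp

section \<open>Concavity of desingularizing functions\<close>

lemma concave_tangent:
  fixes \<phi> :: "real \<Rightarrow> real"
  assumes "concave_on S \<phi>" "connected S" "u \<in> interior S" "w \<in> S"
    and "(\<phi> has_real_derivative d) (at u)"
  shows "\<phi> w - \<phi> u \<le> d * (w - u)"
proof -
  have "(- \<phi> has_real_derivative - d) (at u within S)"
    using DERIV_minus[OF assms(5)] unfolding fun_Compl_def
    by (rule has_field_derivative_at_within)
  from convex_on_imp_above_tangent[of S "- \<phi>", OF _ assms(2,3,4) this] assms(1)
  show ?thesis
    by (simp add: concave_on_def fun_Compl_def)
qed

lemma desingularizing_DERIV:
  assumes "desingularizing \<eta> \<phi>" "0 < t" "ereal t < \<eta>"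
  shows "(\<phi> has_real_derivative deriv \<phi> t) (at t)" "0 < deriv \<phi> t"
proof -
  have "\<phi> differentiable (at t)"
    using assms by (auto simp: desingularizing_def C1_differentiable_on_eq)
  then show "(\<phi> has_real_derivative deriv \<phi> t) (at t)"
    by (simp add: DERIV_deriv_iff_real_differentiable)
  show "0 < deriv \<phi> t"
    using assms by (auto simp: desingularizing_def)
qed

lemma desingularizing_tangent:
  assumes "desingularizing \<eta> \<phi>" "0 < u" "ereal u < \<eta>" "0 < w" "ereal w < \<eta>"
  shows "\<phi> w - \<phi> u \<le> deriv \<phi> u * (w - u)"
proof (rule concave_tangent)
  let ?S = "{t. 0 \<le> t \<and> ereal t < \<eta>}"
  show "concave_on ?S \<phi>" using assms(1) by (simp add: desingularizing_def)
  have "is_interval ?S"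
    unfolding is_interval_1 by (auto intro: le_less_trans[OF iffD2[OF ereal_less_eq(3)]])
  then show "connected ?S" by (simp add: is_interval_connected_1)
  \<comment> \<open>As \<open>\<eta>\<close> may be infinite, a real \<open>b\<close> between
    \<open>u\<close> and \<open>\<eta>\<close> is chosen to put \<open>u\<close> in the interior of
    the domain.\<close>
  obtain b where b: "u < b" "ereal b < \<eta>"
    using ereal_dense2[OF assms(3)] by auto
  then have "{0<..<b} \<subseteq> ?S"
    by (auto intro: less_trans[OF iffD2[OF less_ereal.simps(1)]])
  then show "u \<in> interior ?S"
    using b assms(2) by (intro interiorI[of "{0<..<b}"]) auto
  show "w \<in> ?S" using assms by simp
  show "(\<phi> has_real_derivative deriv \<phi> u) (at u)"
    using assms by (intro desingularizing_DERIV)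
qed

text \<open>Adding the tangent inequalities at \<open>u\<close> and at \<open>w\<close> suffices.
  This moves the PLK bound from the objective gap to half the energy.\<close>

lemma desingularizing_deriv_antimono:
  assumes "desingularizing \<eta> \<phi>" "0 < w" "w \<le> u" "ereal u < \<eta>"
  shows "deriv \<phi> u \<le> deriv \<phi> w"
proof (cases "w = u")
  case False
  have w: "ereal w < \<eta>" using assms by (auto intro: le_less_trans[of _ "ereal u"])
  have "\<phi> w - \<phi> u \<le> deriv \<phi> u * (w - u)" "\<phi> u - \<phi> w \<le> deriv \<phi> w * (u - w)"
    using assms w by (auto intro!: desingularizing_tangent[of \<eta>])
  then have "deriv \<phi> u * (u - w) \<le> deriv \<phi> w * (u - w)"
    by (simp add: algebra_simps)
  then show ?thesis using assms False by simp
qed simp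

section \<open>Sequences of finite length\<close>

text \<open>Restricting the increment bound to indices below \<open>n\<close> lets a strong
  induction apply it while only earlier iterates are known to be near the limit.\<close>

lemma telescoped_norm_bound:
  fixes x :: "nat \<Rightarrow> 'a::real_normed_vector" and \<Phi> :: "nat \<Rightarrow> real"
  assumes "K \<le> n"
    and "\<And>k. K \<le> k \<Longrightarrow> k < n \<Longrightarrow> norm (x (Suc k) - x k) \<le> \<Phi> k - \<Phi> (Suc k)"
  shows "norm (x n - x K) \<le> \<Phi> K - \<Phi> n"
  using assms
proof (induction n rule: dec_induct)
  case (step n)
  have "norm (x (Suc n) - x K) \<le> norm (x (Suc n) - x n) + norm (x n - x K)"
    by norm
  with step.IH step.prems step.hyps show ?case
    by (smt (verit, ccfv_SIG) less_Suc_eq)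
qed simp

text \<open>The bound on the increments is only available near the accumulation point, so the
  iterates must be shown never to leave the ball once they are deep enough inside it.\<close>

lemma finite_length_convergence:
  fixes x :: "nat \<Rightarrow> 'a::real_normed_vector" and \<Phi> :: "nat \<Rightarrow> real"
  assumes acc: "accumulation_point x l" and \<epsilon>: "0 < \<epsilon>"
    and mono: "\<And>k. K \<le> k \<Longrightarrow> \<Phi> (Suc k) \<le> \<Phi> k"
    and low: "\<And>k. K \<le> k \<Longrightarrow> 0 \<le> \<Phi> k"
    and inc: "\<And>k. K \<le> k \<Longrightarrow> x k \<in> ball l \<epsilon> \<Longrightarrow> norm (x (Suc k) - x k) \<le> \<Phi> k - \<Phi> (Suc k)"
  shows "x \<longlonglongrightarrow> l"
proof -
  have "decseq (\<lambda>n. \<Phi> (n + K))"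
    by (rule decseq_SucI) (simp add: mono)
  then obtain m where "(\<lambda>n. \<Phi> (n + K)) \<longlonglongrightarrow> m" and m: "\<And>n. m \<le> \<Phi> (n + K)"
    using low decseq_convergent[of "\<lambda>n. \<Phi> (n + K)" 0] by auto
  then have lim: "\<Phi> \<longlonglongrightarrow> m" by (simp add: LIMSEQ_offset)
  have low_m: "m \<le> \<Phi> k" if "K \<le> k" for k
    using m[of "k - K"] that by simp
  obtain r where r: "strict_mono r" "(x \<circ> r) \<longlonglongrightarrow> l"
    using acc by (auto simp: accumulation_point_def)
  show ?thesis
  proof (rule LIMSEQ_I)
    fix e0 :: real assume "0 < e0"
    define e where "e = min e0 \<epsilon>"
    have e: "0 < e" using \<open>0 < e0\<close> \<epsilon> by (simp add: e_def)
    \<comment> \<open>Far along the subsequence, the remaining budget above \<open>m\<close> and the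
      distance to \<open>l\<close> are both below \<open>e / 2\<close>; \<open>N\<close> is such an
      index.\<close>
    have "\<forall>\<^sub>F n in sequentially. \<Phi> (r n) < m + e / 2"
      using LIMSEQ_subseq_LIMSEQ[OF lim r(1)] e by (auto simp: o_def intro: order_tendstoD)
    moreover have "\<forall>\<^sub>F n in sequentially. dist ((x \<circ> r) n) l < e / 2"
      using tendstoD[OF r(2), of "e / 2"] e by simp
    moreover have "\<forall>\<^sub>F n in sequentially. K \<le> r n"
      using eventually_ge_at_top[of K] by eventually_elim (use r(1) seq_suble in \<open>blast intro: order_trans\<close>)
    ultimately have "\<forall>\<^sub>F n in sequentially. \<Phi> (r n) < m + e / 2 \<and> dist ((x \<circ> r) n) l < e / 2 \<and> K \<le> r n"
      by eventually_elim simp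
    then obtain n where "\<Phi> (r n) < m + e / 2" "dist ((x \<circ> r) n) l < e / 2" "K \<le> r n"
      by (metis (mono_tags, lifting) eventually_happens' sequentially_bot)
    then obtain N where N: "\<Phi> N < m + e / 2" "norm (x N - l) < e / 2" "K \<le> N"
      by (auto simp: dist_norm)
    \<comment> \<open>If all iterates from \<open>N\<close> up to \<open>n - 1\<close> stay in the
      ball, their increments telescope, so \<open>x n\<close> is within \<open>e / 2\<close> of
      \<open>x N\<close> and hence within \<open>e\<close> of \<open>l\<close>.\<close>
    have "norm (x n - l) < e" if "N \<le> n" for n
      using that
    proof (induction n rule: less_induct)
      case (less n)
      have "norm (x n - x N) \<le> \<Phi> N - \<Phi> n"
      proof (rule telescoped_norm_bound[OF less.prems])
        fix k assume "N \<le> k" "k < n"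
        with less.IH[of k] have "x k \<in> ball l \<epsilon>"
          by (simp add: dist_norm norm_minus_commute e_def)
        with \<open>N \<le> k\<close> N show "norm (x (Suc k) - x k) \<le> \<Phi> k - \<Phi> (Suc k)"
          by (intro inc) auto
      qed
      also have "\<dots> < e / 2" using N low_m[of n] less.prems by simp
      finally show ?case using N(2) norm_triangle_ineq[of "x n - x N" "x N - l"] by simp
    qed
    then show "\<exists>N. \<forall>n\<ge>N. norm (x n - l) < e0"
      by (auto simp: e_def)
  qed
qed

text \<open>\<open>\<Phi> k\<close> caps the path length remaining after \<open>k\<close>; letting
  the end index tend to infinity turns the decay of \<open>\<Phi>\<close> into a rate for the
  iterates.\<close>

lemma limit_distance_bound:
  fixes x :: "nat \<Rightarrow> 'a::real_normed_vector" and \<Phi> :: "nat \<Rightarrow> real"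
  assumes lim: "x \<longlonglongrightarrow> l"
    and low: "\<And>k. K \<le> k \<Longrightarrow> 0 \<le> \<Phi> k"
    and inc: "\<And>k. K \<le> k \<Longrightarrow> norm (x (Suc k) - x k) \<le> \<Phi> k - \<Phi> (Suc k)"
    and k: "K \<le> k"
  shows "norm (x k - l) \<le> \<Phi> k"
proof -
  have "norm (x n - x k) \<le> \<Phi> k" if "k \<le> n" for n
    using telescoped_norm_bound[of k n x \<Phi>] that k inc low[of n] by force
  moreover have "(\<lambda>n. norm (x n - x k)) \<longlonglongrightarrow> norm (l - x k)"
    using lim by (intro tendsto_intros)
  ultimately have "norm (l - x k) \<le> \<Phi> k"
    using Lim_bounded by blast
  then show ?thesis by (simp add: norm_minus_commute)
qed

text \<open>Serves to carry the rate of the iterates over to gradients and function values.\<close>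

lemma converges_linearly_mono:
  fixes x :: "nat \<Rightarrow> 'a::real_normed_vector" and y :: "nat \<Rightarrow> 'b::real_normed_vector"
  assumes "converges_linearly x l"
    and "\<forall>\<^sub>F k in sequentially. norm (y k - m) \<le> B * norm (x k - l)"
  shows "converges_linearly y m"
proof -
  obtain \<mu> where \<mu>: "0 < \<mu>" "\<mu> < 1" "(\<lambda>k. norm (x k - l)) \<in> O(\<lambda>k. \<mu> ^ k)"
    using assms(1) by (auto simp: converges_linearly_def)
  have "(\<lambda>k. norm (y k - m)) \<in> O(\<lambda>k. norm (x k - l))"
    using assms(2) by (intro bigoI[of _ B]) simp
  with \<mu> show ?thesis
    unfolding converges_linearly_def by (blast intro: landau_o.big_trans)
qed

section \<open>Inertial descent under the PLK condition\<close>

text \<open>An energy \<open>D\<close> that dominates the objective gap together with the squared velocity;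
  \<open>s k\<close> measures the size of the \<open>k\<close>-th step.\<close>

locale inertial_descent =
  fixes f :: "'a::euclidean_space \<Rightarrow> real" and x :: "nat \<Rightarrow> 'a" and xbar :: 'a
    and D s :: "nat \<Rightarrow> real" and c \<sigma> C :: real
  assumes c: "0 < c" and \<sigma>: "0 < \<sigma>" and C: "0 < C"
    and D_eq: "1 \<le> k \<Longrightarrow> D k = f (x k) - f xbar + c * (norm (x k - x (k - 1)))\<^sup>2"
    and D_pos: "1 \<le> k \<Longrightarrow> 0 < D k"
    and D_lim: "D \<longlonglongrightarrow> 0"
    and D_step: "1 \<le> k \<Longrightarrow> \<sigma> * (s k)\<^sup>2 \<le> D k - D (Suc k)"
    and velocity: "1 \<le> k \<Longrightarrow> norm (x k - x (k - 1)) \<le> s k"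
    and increment: "1 \<le> k \<Longrightarrow> norm (x (Suc k) - x k) \<le> s k"
    and gradient: "1 \<le> k \<Longrightarrow> norm (grad f (x k)) \<le> C * s k"
    and accum: "accumulation_point x xbar"
begin

lemma s_nonneg: "1 \<le> k \<Longrightarrow> 0 \<le> s k"
  using velocity norm_ge_zero by (rule order_trans[rotated])

lemma D_decreasing: "1 \<le> k \<Longrightarrow> D (Suc k) \<le> D k"
  using D_step[of k] \<sigma> by (smt (verit) mult_nonneg_nonneg zero_le_power2)

lemma gap_le_D: "1 \<le> k \<Longrightarrow> f (x k) - f xbar \<le> D k"
  using c by (simp add: D_eq)

text \<open>Either the velocity accounts for half of the energy, and the square root desingularizes it,
  or the objective gap does, and the PLK inequality at \<open>x k\<close> can be used.\<close>

lemma energy_dichotomy: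
  assumes "1 \<le> k"
  obtains (kinetic) "sqrt (D k) \<le> sqrt (2 * c) * s k" | (gap) "D k / 2 < f (x k) - f xbar"
proof (cases "D k / 2 < f (x k) - f xbar")
  case False
  have "D k \<le> 2 * c * (norm (x k - x (k - 1)))\<^sup>2"
    using False D_eq[OF assms] by simp
  also have "\<dots> \<le> 2 * c * (s k)\<^sup>2"
    using velocity[OF assms] c by (intro mult_left_mono power_mono) auto
  finally have "sqrt (D k) \<le> sqrt (2 * c * (s k)\<^sup>2)"
    by (rule real_sqrt_le_mono)
  then show ?thesis
    using s_nonneg[OF assms] by (intro that(1)) (simp add: real_sqrt_mult)
qed (use that in blast)

lemma eventually_D_less:
  assumes "0 < t"
  obtains K where "1 \<le> K" "\<And>k. K \<le> k \<Longrightarrow> D k < t"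
proof -
  have "\<forall>\<^sub>F k in sequentially. 1 \<le> k \<and> D k < t"
    using eventually_ge_at_top[of 1] order_tendstoD(2)[OF D_lim assms] by eventually_elim simp
  then show ?thesis
    using that unfolding eventually_sequentially by blast
qed

text \<open>The velocity part of the energy is absorbed by adding a square root to the desingularizing
  function. Since \<open>\<phi>\<close> may jump at 0, \<open>\<Phi>\<close> need not tend to 0, but it is monotone.\<close>

lemma PLK_convergence:
  assumes "PLK_with f xbar \<phi>"
  shows "x \<longlonglongrightarrow> xbar"
proof -
  obtain \<eta> U where \<eta>: "0 < \<eta>" and U: "xbar \<in> interior U" and \<phi>: "desingularizing \<eta> \<phi>"
    and plk: "\<And>y. y \<in> U \<Longrightarrow> f xbar < f y \<Longrightarrow> ereal (f y) < ereal (f xbar) + \<eta> \<Longrightarrow>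
      1 \<le> deriv \<phi> (f y - f xbar) * norm (grad f y)"
    using assms unfolding PLK_with_def by blast
  obtain \<epsilon> where \<epsilon>: "0 < \<epsilon>" "ball xbar \<epsilon> \<subseteq> U"
    using U unfolding mem_interior by blast
  \<comment> \<open>A real threshold in the domain: once \<open>D k < t\<close>, the half energy and
    the gap both lie below \<open>\<eta>\<close>.\<close>
  obtain t where t: "0 < t" "ereal t < \<eta>"
    using ereal_dense2[OF \<eta>] by auto
  obtain K where K: "1 \<le> K" "\<And>k. K \<le> k \<Longrightarrow> D k < t"
    using eventually_D_less[OF t(1)] by blast
  have less_\<eta>: "ereal a < \<eta>" if "a < t" for a
    using that t(2) by (meson ereal_less_eq(3) le_less_trans less_imp_le)
  \<comment> \<open>The factors with which the gap case (\<open>a\<close>) and the kinetic case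
    (\<open>b\<close>) below bound \<open>s k\<close>.\<close>
  define a b where "a = 2 * C / \<sigma>" and "b = 2 * sqrt (2 * c) / \<sigma>"
  have ab: "0 < a" "0 < b" using C \<sigma> c by (auto simp: a_def b_def)
  define \<Phi> where "\<Phi> k = a * \<phi> (D k / 2) + b * sqrt (D k)" for k
  have half: "0 < D k / 2" "ereal (D k / 2) < \<eta>" if "K \<le> k" for k
    using D_pos[of k] K(1) K(2)[OF that] that by (auto intro!: less_\<eta>)
  have \<phi>_step: "deriv \<phi> (D k / 2) * ((D k - D (Suc k)) / 2) \<le> \<phi> (D k / 2) - \<phi> (D (Suc k) / 2)"
    if "K \<le> k" for k
    using desingularizing_tangent[OF \<phi> half[OF that] half[of "Suc k"]] that
    by (simp add: field_simps)
  have \<phi>_mono: "\<phi> (D (Suc k) / 2) \<le> \<phi> (D k / 2)" if "K \<le> k" for k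
  proof -
    have "0 \<le> deriv \<phi> (D k / 2) * ((D k - D (Suc k)) / 2)"
      using desingularizing_DERIV(2)[OF \<phi> half[OF that]] D_decreasing[of k] K(1) that by simp
    with \<phi>_step[OF that] show ?thesis by simp
  qed
  have sqrt_mono: "sqrt (D (Suc k)) \<le> sqrt (D k)" if "K \<le> k" for k
    using D_decreasing[of k] K(1) that by simp
  have "s k \<le> \<Phi> k - \<Phi> (Suc k)" if k: "K \<le> k" and U: "x k \<in> U" for k
  proof -
    have k1: "1 \<le> k" using K(1) k by simp
    have *: "a * (\<phi> (D k / 2) - \<phi> (D (Suc k) / 2)) + b * (sqrt (D k) - sqrt (D (Suc k)))
        = \<Phi> k - \<Phi> (Suc k)"
      by (simp add: \<Phi>_def algebra_simps)
    show ?thesis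
      using k1
    proof (cases rule: energy_dichotomy)
      case kinetic
      have "0 < s k"
        using kinetic D_pos[OF k1] c s_nonneg[OF k1] by (cases "s k = 0") auto
      \<comment> \<open>The energy drop factors as a difference of squares; the sum of the roots is
        at most \<open>2 * sqrt (2 * c) * s k\<close>, so one factor \<open>s k\<close>
        cancels.\<close>
      have "\<sigma> * (s k)\<^sup>2 \<le> (sqrt (D k))\<^sup>2 - (sqrt (D (Suc k)))\<^sup>2"
        using D_step[OF k1] D_pos[OF k1] D_pos[of "Suc k"] by simp
      also have "\<dots> = (sqrt (D k) - sqrt (D (Suc k))) * (sqrt (D k) + sqrt (D (Suc k)))"
        by (simp add: power2_eq_square algebra_simps)
      also have "\<dots> \<le> (sqrt (D k) - sqrt (D (Suc k))) * (2 * (sqrt (2 * c) * s k))"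
      proof (rule mult_left_mono)
        show "sqrt (D k) + sqrt (D (Suc k)) \<le> 2 * (sqrt (2 * c) * s k)"
          using sqrt_mono[OF k] kinetic by linarith
      qed (use sqrt_mono[OF k] in simp)
      finally have "\<sigma> * s k \<le> (sqrt (D k) - sqrt (D (Suc k))) * (2 * sqrt (2 * c))"
        using \<open>0 < s k\<close> by (simp add: power2_eq_square mult.assoc mult.left_commute[of _ "s k"])
      then have "s k \<le> b * (sqrt (D k) - sqrt (D (Suc k)))"
        using \<sigma> by (simp add: b_def field_simps)
      moreover have "0 \<le> a * (\<phi> (D k / 2) - \<phi> (D (Suc k) / 2))"
        using ab \<phi>_mono[OF k] by simp
      ultimately show ?thesis using * by linarith
    next
      case gap
      let ?u = "f (x k) - f xbar"
      have "?u < t" using gap_le_D[OF k1] K(2)[OF k] by simp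
      then have u\<eta>: "ereal ?u < \<eta>" by (rule less_\<eta>)
      have "0 < ?u" using gap half(1)[OF k] by simp
      moreover have "ereal (f (x k)) < ereal (f xbar) + \<eta>"
        using u\<eta> by (cases \<eta>) auto
      ultimately have "1 \<le> deriv \<phi> ?u * norm (grad f (x k))"
        using plk[OF U] by simp
      \<comment> \<open>The gap exceeds \<open>D k / 2\<close> and the slope of
        \<open>\<phi>\<close> is antitone. The energy decreases, whereas the gap need not, so the
        slope is taken at the half energy to make the sum telescope.\<close>
      also have "\<dots> \<le> deriv \<phi> (D k / 2) * (C * s k)"
        using desingularizing_deriv_antimono[OF \<phi> half(1)[OF k] _ u\<eta>] gap gradient[OF k1]
          desingularizing_DERIV(2)[OF \<phi> half[OF k]]
        by (intro mult_mono) auto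
      finally have "\<sigma> * s k * 1 \<le> \<sigma> * s k * (deriv \<phi> (D k / 2) * (C * s k))"
        using \<sigma> s_nonneg[OF k1] by (intro mult_left_mono) auto
      also have "\<dots> = 2 * C * (deriv \<phi> (D k / 2) * (\<sigma> * (s k)\<^sup>2 / 2))"
        by (simp add: power2_eq_square)
      also have "\<dots> \<le> 2 * C * (deriv \<phi> (D k / 2) * ((D k - D (Suc k)) / 2))"
        using C D_step[OF k1] desingularizing_DERIV(2)[OF \<phi> half[OF k]]
        by (intro mult_left_mono divide_right_mono) auto
      also have "\<dots> \<le> 2 * C * (\<phi> (D k / 2) - \<phi> (D (Suc k) / 2))"
        using C \<phi>_step[OF k] by (intro mult_left_mono) auto
      finally have "s k \<le> a * (\<phi> (D k / 2) - \<phi> (D (Suc k) / 2))"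
        using \<sigma> by (simp add: a_def field_simps)
      moreover have "0 \<le> b * (sqrt (D k) - sqrt (D (Suc k)))"
        using ab sqrt_mono[OF k] by simp
      ultimately show ?thesis using * by linarith
    qed
  qed
  moreover have "\<Phi> (Suc k) \<le> \<Phi> k" if "K \<le> k" for k
    unfolding \<Phi>_def using ab \<phi>_mono[OF that] sqrt_mono[OF that]
    by (intro add_mono mult_left_mono) auto
  moreover have "0 \<le> \<Phi> k" if "K \<le> k" for k
    using \<phi> half[OF that] ab by (auto simp: \<Phi>_def desingularizing_def intro!: add_nonneg_nonneg)
  ultimately show ?thesis
    using \<epsilon> K(1) increment
    by (intro finite_length_convergence[OF accum \<epsilon>(1), of K \<Phi>])
      (meson order_trans subsetD)+
qed

section \<open>Rates for power desingularization\<close>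

text \<open>The kinetic alternative contributes the exponent \<open>1 / 2\<close>, the gap
  alternative \<open>q\<close>. For energies below 1 the larger exponent gives the weaker
  inequality, so \<open>p\<close> serves both.\<close>

context
  fixes M q p :: real
  assumes plk: "PLK_with f xbar (\<lambda>t. M * t powr (1 - q))"
    and M: "0 < M" and q: "0 \<le> q" "q < 1"
  defines "p \<equiv> max q (1 / 2)"
begin

lemma p_bounds: "1 / 2 \<le> p" "q \<le> p" "p < 1"
  using q by (auto simp: p_def)

text \<open>A Lojasiewicz inequality for the energy, with \<open>s k\<close> in the place of the
  gradient norm; the two summands of the constant come from the two alternatives.\<close>

lemma energy_powr_le_step:
  obtains A K where "0 < A" "1 \<le> K" "\<And>k. K \<le> k \<Longrightarrow> D k powr p \<le> A * s k"
proof -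
  obtain \<eta> U where \<eta>: "0 < \<eta>" and U: "xbar \<in> interior U"
    and ineq: "\<And>y. y \<in> U \<Longrightarrow> f xbar < f y \<Longrightarrow> ereal (f y) < ereal (f xbar) + \<eta> \<Longrightarrow>
      1 \<le> deriv (\<lambda>t. M * t powr (1 - q)) (f y - f xbar) * norm (grad f y)"
    using plk unfolding PLK_with_def by blast
  obtain t where t: "0 < t" "ereal t < \<eta>"
    using ereal_dense2[OF \<eta>] by auto
  \<comment> \<open>The cap 1 makes powers of \<open>D k\<close> decrease in the exponent, so
    exponents can be raised to \<open>p\<close>.\<close>
  obtain K1 where K1: "1 \<le> K1" "\<And>k. K1 \<le> k \<Longrightarrow> D k < min t 1"
    using eventually_D_less[of "min t 1"] t by auto
  have "\<forall>\<^sub>F k in sequentially. x k \<in> interior U"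
    using PLK_convergence[OF plk] U by (intro topological_tendstoD) auto
  then obtain K2 where K2: "\<And>k. K2 \<le> k \<Longrightarrow> x k \<in> U"
    using interior_subset unfolding eventually_sequentially by blast
  let ?A = "sqrt (2 * c) + 2 * M * (1 - q) * C"
  have "D k powr p \<le> ?A * s k" if k: "max K1 K2 \<le> k" for k
  proof -
    have k1: "1 \<le> k" and D1: "0 < D k" "D k < 1" "D k < t"
      using K1 k D_pos[of k] by (auto simp: less_imp_le)
    have s0: "0 \<le> s k" using k1 by (rule s_nonneg)
    show ?thesis
      using k1
    proof (cases rule: energy_dichotomy)
      case kinetic
      have "D k powr p \<le> D k powr (1 / 2)"
        using D1 p_bounds by (intro powr_mono') auto
      also have "\<dots> \<le> sqrt (2 * c) * s k"
        using kinetic D1 by (simp add: powr_half_sqrt)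
      also have "\<dots> \<le> ?A * s k"
        using s0 M q C by (intro mult_right_mono) auto
      finally show ?thesis .
    next
      case gap
      let ?u = "f (x k) - f xbar"
      have u: "0 < ?u" "?u < t" using gap D1 gap_le_D[OF k1] by auto
      then have "ereal (f (x k)) < ereal (f xbar) + \<eta>"
        using t(2) by (cases \<eta>) auto
      then have 1: "1 \<le> deriv (\<lambda>t. M * t powr (1 - q)) ?u * norm (grad f (x k))"
        using u k K2 by (intro ineq) auto
      have "((\<lambda>t. M * t powr (1 - q)) has_real_derivative M * ((1 - q) * ?u powr (1 - q - 1))) (at ?u)"
        using u by (auto intro!: derivative_eq_intros)
      then have "deriv (\<lambda>t. M * t powr (1 - q)) ?u = M * (1 - q) * ?u powr (- q)"
        by (subst DERIV_imp_deriv) (auto simp: algebra_simps)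
      with 1 have "1 \<le> M * (1 - q) * ?u powr (- q) * norm (grad f (x k))" by simp
      also have "\<dots> \<le> M * (1 - q) * ?u powr (- q) * (C * s k)"
        using gradient[OF k1] M q by (intro mult_left_mono) auto
      finally have "?u powr q * 1 \<le> ?u powr q * (M * (1 - q) * ?u powr (- q) * (C * s k))"
        by (intro mult_left_mono) auto
      also have "\<dots> = M * (1 - q) * (C * s k) * (?u powr q * ?u powr (- q))" by simp
      also have "?u powr q * ?u powr (- q) = 1"
        using u by (simp flip: powr_add)
      finally have uq: "?u powr q \<le> M * (1 - q) * C * s k" by simp
      have "D k powr p \<le> D k powr q"
        using D1 p_bounds by (intro powr_mono') auto
      \<comment> \<open>In this case \<open>D k < 2 * ?u\<close>; the resulting factor
        \<open>2 powr q\<close> is at most 2, the 2 in \<open>?A\<close>.\<close>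
      also have "\<dots> \<le> (2 * ?u) powr q"
        using gap D1 q by (intro powr_mono2) auto
      also have "\<dots> = 2 powr q * ?u powr q"
        by (rule powr_mult)
      also have "\<dots> \<le> 2 powr 1 * (M * (1 - q) * C * s k)"
        using uq q by (intro mult_mono powr_mono) auto
      also have "\<dots> \<le> ?A * s k"
        using s0 c by (simp add: algebra_simps)
      finally show ?thesis .
    qed
  qed
  moreover have "0 < ?A" using c M q C by (intro add_pos_nonneg) auto
  ultimately show ?thesis
    using K1(1) that[of ?A "max K1 K2"] by auto
qed

text \<open>Squaring \<open>D k powr p \<le> A * s k\<close> turns the energy decrease into the
  recursion. Multiplied by \<open>D k powr (- p)\<close>, the same bound meets the tangent slope of
  \<open>t powr (1 - p)\<close>, whose concavity makes the increments telescope.\<close>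

lemma energy_rates:
  obtains A \<kappa> K where "0 < A" "0 < \<kappa>" "1 \<le> K"
    "\<And>k. K \<le> k \<Longrightarrow> norm (x k - xbar) \<le> A * D k powr (1 - p)"
    "\<And>k. K \<le> k \<Longrightarrow> \<kappa> * D k powr (2 * p) \<le> D k - D (Suc k)"
proof -
  obtain A K where A: "0 < A" and K: "1 \<le> K" and powr_le: "\<And>k. K \<le> k \<Longrightarrow> D k powr p \<le> A * s k"
    by (rule energy_powr_le_step) blast
  have "\<sigma> / A\<^sup>2 * D k powr (2 * p) \<le> D k - D (Suc k)" if k: "K \<le> k" for k
  proof -
    have "D k powr (2 * p) = (D k powr p)\<^sup>2"
      by (simp add: power2_eq_square flip: powr_add)
    also have "\<dots> \<le> (A * s k)\<^sup>2"
      using powr_le[OF k] by (intro power_mono) auto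
    finally have "\<sigma> / A\<^sup>2 * D k powr (2 * p) \<le> \<sigma> / A\<^sup>2 * (A * s k)\<^sup>2"
      using \<sigma> A by (intro mult_left_mono) auto
    also have "\<dots> = \<sigma> * (s k)\<^sup>2" using A by (simp add: power_mult_distrib)
    also have "\<dots> \<le> D k - D (Suc k)" using D_step k K by simp
    finally show ?thesis .
  qed
  moreover define B where "B = A / ((1 - p) * \<sigma>)"
  have B: "0 < B" using A \<sigma> p_bounds by (simp add: B_def)
  have inc: "norm (x (Suc k) - x k) \<le> B * D k powr (1 - p) - B * D (Suc k) powr (1 - p)"
    if k: "K \<le> k" for k
  proof -
    have k1: "1 \<le> k" using k K by simp
    have s0: "0 \<le> s k" using k1 by (rule s_nonneg)
    have "(1 - p) * \<sigma> * s k * (D k powr p * D k powr (- p))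
        \<le> (1 - p) * \<sigma> * s k * (A * s k * D k powr (- p))"
      using powr_le[OF k] s0 p_bounds \<sigma> by (intro mult_left_mono mult_right_mono) auto
    moreover have "D k powr p * D k powr (- p) = 1"
      using D_pos[OF k1] by (simp flip: powr_add)
    ultimately have "(1 - p) * \<sigma> * s k \<le> A * ((1 - p) * D k powr (- p) * (\<sigma> * (s k)\<^sup>2))"
      by (simp add: power2_eq_square mult_ac)
    also have "\<dots> \<le> A * ((1 - p) * D k powr (- p) * (D k - D (Suc k)))"
      using D_step[OF k1] A p_bounds by (intro mult_left_mono) auto
    also have "\<dots> \<le> A * (D k powr (1 - p) - D (Suc k) powr (1 - p))"
      using powr_concave_tangent[of "1 - p" "D k" "D (Suc k)"] D_pos[OF k1] D_pos[of "Suc k"] A p_bounds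
      by (intro mult_left_mono) auto
    finally have "s k \<le> B * (D k powr (1 - p) - D (Suc k) powr (1 - p))"
      using \<sigma> p_bounds by (simp add: B_def field_simps)
    with increment[OF k1] show ?thesis by (simp add: right_diff_distrib)
  qed
  have "norm (x k - xbar) \<le> B * D k powr (1 - p)" if "K \<le> k" for k
    using B inc that
    by (intro limit_distance_bound[OF PLK_convergence[OF plk], of K "\<lambda>k. B * D k powr (1 - p)"]) auto
  moreover have "0 < \<sigma> / A\<^sup>2" using \<sigma> A by simp
  ultimately show ?thesis
    using that[of B "\<sigma> / A\<^sup>2" K] B K by blast
qed

text \<open>With \<open>2 * p = 1\<close> the recursion contracts the energy by
  \<open>1 - \<kappa>\<close>, and the distance is controlled by the root of the energy, hence the
  ratio \<open>sqrt (1 - \<kappa>)\<close>.\<close>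

lemma linear_convergence:
  assumes "q \<le> 1 / 2"
  shows "converges_linearly x xbar"
proof -
  have p: "p = 1 / 2" using assms by (simp add: p_def)
  obtain A \<kappa> K where A: "0 < A" and \<kappa>: "0 < \<kappa>" and K: "1 \<le> K"
    and dist: "\<And>k. K \<le> k \<Longrightarrow> norm (x k - xbar) \<le> A * D k powr (1 - p)"
    and rec: "\<And>k. K \<le> k \<Longrightarrow> \<kappa> * D k powr (2 * p) \<le> D k - D (Suc k)"
    by (rule energy_rates) blast
  have pos: "0 < D k" if "K \<le> k" for k
    using D_pos K that by simp
  have D_rec: "D (Suc k) \<le> (1 - \<kappa>) * D k" if "K \<le> k" for k
    using rec[OF that] pos[OF that] by (simp add: p algebra_simps)
  \<comment> \<open>Positivity of the next energy forces \<open>\<kappa> < 1\<close>, so the ratio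
    is positive.\<close>
  have "0 < (1 - \<kappa>) * D K"
    using D_rec[of K] pos[of "Suc K"] by simp
  then have \<kappa>1: "\<kappa> < 1" using pos[of K] by (simp add: zero_less_mult_iff)
  let ?\<mu> = "sqrt (1 - \<kappa>)"
  let ?c = "A * sqrt (D K) / ?\<mu> ^ K"
  have "norm (x k - xbar) \<le> ?c * ?\<mu> ^ k" if "K \<le> k" for k
  proof -
    have "D k \<le> D K * (1 - \<kappa>) ^ (k - K)"
      using \<kappa>1 D_rec that by (intro geometric_recursion_decay) auto
    then have "sqrt (D k) \<le> sqrt (D K * (1 - \<kappa>) ^ (k - K))"
      by (rule real_sqrt_le_mono)
    also have "\<dots> = sqrt (D K) * (?\<mu> ^ k / ?\<mu> ^ K)"
      using that \<kappa>1 by (simp add: real_sqrt_mult real_sqrt_divide real_sqrt_power power_diff)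
    finally have "A * sqrt (D k) \<le> A * (sqrt (D K) * (?\<mu> ^ k / ?\<mu> ^ K))"
      using A by (intro mult_left_mono) auto
    with dist[OF that] pos[OF that] show ?thesis
      by (simp add: p powr_half_sqrt)
  qed
  then have "(\<lambda>k. norm (x k - xbar)) \<in> O(\<lambda>k. ?\<mu> ^ k)"
    using \<kappa>1 by (intro bigoI[of _ ?c] eventually_sequentiallyI[of K]) auto
  moreover have "0 < ?\<mu>" "?\<mu> < 1" using \<kappa> \<kappa>1 by auto
  ultimately show ?thesis
    unfolding converges_linearly_def by blast
qed

text \<open>Here \<open>2 * p = r + 1\<close> with \<open>r = 2 * q - 1\<close>, so the energy
  decays with exponent \<open>- 1 / r\<close>; the distance bound raises this to the power
  \<open>1 - q\<close>.\<close>

lemma sublinear_convergence: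
  assumes q2: "1 / 2 < q"
  shows "(\<lambda>k. norm (x k - xbar)) \<in> O(\<lambda>k. real k powr (- ((1 - q) / (2 * q - 1))))"
proof -
  have p: "p = q" using assms by (simp add: p_def)
  obtain A \<kappa> K where A: "0 < A" and \<kappa>: "0 < \<kappa>" and K: "1 \<le> K"
    and dist: "\<And>k. K \<le> k \<Longrightarrow> norm (x k - xbar) \<le> A * D k powr (1 - p)"
    and rec: "\<And>k. K \<le> k \<Longrightarrow> \<kappa> * D k powr (2 * p) \<le> D k - D (Suc k)"
    by (rule energy_rates) blast
  have pos: "0 < D k" if "K \<le> k" for k
    using D_pos K that by simp
  obtain B where B: "0 < B"
    and decay: "\<And>k. 2 * K + 1 \<le> k \<Longrightarrow> D k \<le> B * real k powr (- (1 / (2 * q - 1)))"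
    using powr_recursion_decay[of "2 * q - 1" \<kappa> K D] q2 \<kappa> rec pos by (auto simp: p)
  have "norm (x k - xbar) \<le> A * B powr (1 - q) * real k powr (- ((1 - q) / (2 * q - 1)))"
    if k: "2 * K + 1 \<le> k" for k
  proof -
    have "D k powr (1 - q) \<le> (B * real k powr (- (1 / (2 * q - 1)))) powr (1 - q)"
      using decay[OF k] pos[of k] k q by (intro powr_mono2) auto
    also have "\<dots> = B powr (1 - q) * real k powr (- ((1 - q) / (2 * q - 1)))"
      by (simp add: powr_mult powr_powr)
    finally have "A * D k powr (1 - q) \<le> A * (B powr (1 - q) * real k powr (- ((1 - q) / (2 * q - 1))))"
      using A by (intro mult_left_mono) auto
    with dist[of k] k show ?thesis by (simp add: p)
  qed
  then show ?thesis
    by (intro bigoI[of _ "A * B powr (1 - q)"] eventually_sequentiallyI[of "2 * K + 1"]) auto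
qed

end

end

section \<open>Sharpness-aware minimization with momentum\<close>

text \<open>The error is at most \<open>\<nu> / (\<nu> + 1)\<close> times \<open>norm (G u)\<close>,
  and \<open>norm (G u)\<close> is at most the error plus the norm of the perturbed gradient;
  absorbing the error leaves the factor \<open>\<nu>\<close>.\<close>

lemma perturbed_gradient_error:
  fixes G :: "'a::real_normed_vector \<Rightarrow> 'a"
  assumes lip: "\<And>y z. norm (G y - G z) \<le> L * norm (y - z)"
    and L: "0 < L" and \<nu>: "0 \<le> \<nu>" and \<tau>: "0 \<le> \<tau>" "\<tau> \<le> \<nu> / (L * (\<nu> + 1))"
  shows "norm (G u - G (u + \<tau> *\<^sub>R G u)) \<le> \<nu> * norm (G (u + \<tau> *\<^sub>R G u))"
proof -
  let ?g = "G (u + \<tau> *\<^sub>R G u)"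
  have "(\<nu> + 1) * norm (G u - ?g) \<le> (\<nu> + 1) * (L * (\<tau> * norm (G u)))"
    using lip[of u "u + \<tau> *\<^sub>R G u"] \<tau> \<nu> by (intro mult_left_mono) auto
  also have "\<dots> = \<tau> * (L * (\<nu> + 1)) * norm (G u)" by simp
  also have "\<dots> \<le> \<nu> * norm (G u)"
    using \<tau>(2) L \<nu> by (intro mult_right_mono) (auto simp: pos_le_divide_eq)
  also have "\<dots> \<le> \<nu> * (norm (G u - ?g) + norm ?g)"
    using \<nu> norm_triangle_ineq[of "G u - ?g" ?g] by (intro mult_left_mono) auto
  finally show ?thesis by (simp add: algebra_simps)
qed

lemma sum3_squared_le:
  fixes a b c :: real
  shows "(a + b + c)\<^sup>2 \<le> 3 * (a\<^sup>2 + b\<^sup>2 + c\<^sup>2)"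
proof -
  have "0 \<le> (a - b)\<^sup>2 + (b - c)\<^sup>2 + (a - c)\<^sup>2" by simp
  then show ?thesis by (simp add: power2_eq_square algebra_simps)
qed

theorem theorem4p3:
  fixes f :: "real ^ 'n \<Rightarrow> real"
    and x :: "nat \<Rightarrow> real ^ 'n"
    and \<beta> \<gamma> :: "nat \<Rightarrow> real"
    and L \<tau>\<^sub>1 \<tau>\<^sub>2 \<nu> betabar deltabar :: real
  assumes "C1 f"
    and "L > 0"
    and "\<And>y z. norm (grad f y - grad f z) \<le> L * norm (y - z)"
    and "SAMm f \<beta> \<gamma> \<tau>\<^sub>1 \<tau>\<^sub>2 x"
    and "\<And>k. k \<ge> 1 \<Longrightarrow> \<beta> k \<ge> 0"
    and "\<And>k. k \<ge> 1 \<Longrightarrow> \<gamma> k \<ge> 0"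
    and "\<tau>\<^sub>1 > 0" and "\<tau>\<^sub>2 > 0"
    and "bdd_above (\<beta> ` {1..})"
    and "betabar = (SUP k\<in>{1..}. \<beta> k)"
    and "betabar < 1"
    and "bdd_above ((\<lambda>k. \<bar>\<beta> k - \<gamma> k\<bar>) ` {1..})"
    and "deltabar = (SUP k\<in>{1..}. \<bar>\<beta> k - \<gamma> k\<bar>)"
    and "0 < \<nu>" and "\<nu> < 1"
    and "\<tau>\<^sub>2 \<le> \<nu> / (L * (\<nu> + 1))"
    and "max (L * \<tau>\<^sub>1) (2 * L * \<tau>\<^sub>1 * deltabar + (L * \<tau>\<^sub>1 + 1) * betabar\<^sup>2) < 1 - \<nu>"
    and "\<And>k. k \<ge> 1 \<Longrightarrow> grad f (momentum_step \<gamma> x k) \<noteq> 0"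
    and "bdd_below ((\<lambda>k. f (x k)) ` {1..})"
  shows "(\<lambda>k. grad f (x k)) \<longlonglongrightarrow> 0 \<and>
    (\<forall>xbar. accumulation_point x xbar \<and> basic_PLK f xbar \<longrightarrow>
       x \<longlonglongrightarrow> xbar \<and> stationary_point f xbar) \<and>
    (\<forall>xbar M q. accumulation_point x xbar \<and> M > 0 \<and> 0 \<le> q \<and> q < 1 \<and>
         PLK_with f xbar (\<lambda>t. M * t powr (1 - q)) \<longrightarrow>
       (q \<le> 1/2 \<longrightarrow>
          converges_linearly x xbar \<and>
          converges_linearly (\<lambda>k. grad f (x k)) 0 \<and>
          converges_linearly (\<lambda>k. f (x k)) (f xbar)) \<and>
       (1/2 < q \<longrightarrow>
          (\<lambda>k. norm (x k - xbar)) \<in> O(\<lambda>k. real k powr (- ((1 - q) / (2 * q - 1)))) \<and>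
          (\<lambda>k. norm (grad f (x k))) \<in> O(\<lambda>k. real k powr (- ((1 - q) / (2 * q - 1)))) \<and>
          (\<lambda>k. f (x k) - f xbar) \<in> O(\<lambda>k. real k powr (- ((2 - 2 * q) / (2 * q - 1))))))"
proof -
  note lip = assms(3)
  have diff: "GDERIV f z :> grad f z" for z
    using assms(1) by (intro GDERIV_grad) (simp add: C1_def differentiable_on_def)
  have grad_cont: "continuous_on UNIV (grad f)" using assms(1) by (simp add: C1_def)
  have f_cont: "continuous_on UNIV f"
    using assms(1) by (simp add: C1_def differentiable_imp_continuous_on)

  have \<beta>_le: "\<beta> k \<le> betabar" and \<delta>_le: "\<bar>\<beta> k - \<gamma> k\<bar> \<le> deltabar" if "1 \<le> k" for k
    using assms(9,10,12,13) that by (auto intro: cSUP_upper)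
  have bb: "0 \<le> betabar" and dd: "0 \<le> deltabar"
    using \<beta>_le[of 1] \<delta>_le[of 1] assms(5)[of 1] by auto

  define v where "v k = x k - x (k - 1)" for k
  define g where "g k = grad f (momentum_step \<gamma> x k + \<tau>\<^sub>2 *\<^sub>R grad f (momentum_step \<gamma> x k))" for k
  have v_Suc: "v (Suc k) = x (Suc k) - x k" for k by (simp add: v_def)
  have ex: "momentum_step \<gamma> x k = x k + \<gamma> k *\<^sub>R v k" for k
    by (simp add: momentum_step_def v_def)
  have step: "x (Suc k) = x k + \<beta> k *\<^sub>R v k - \<tau>\<^sub>1 *\<^sub>R g k" if "1 \<le> k" for k
    using assms(4) that by (simp add: SAMm_def g_def momentum_step_def v_def)
  have err: "norm (grad f (x k + \<gamma> k *\<^sub>R v k) - g k) \<le> \<nu> * norm (g k)" for k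
    unfolding g_def ex using lip assms(2,8,14,16) by (intro perturbed_gradient_error[where L = L]) auto
  have ex_le: "norm (grad f (x k + \<gamma> k *\<^sub>R v k)) \<le> (1 + \<nu>) * norm (g k)" for k
    using err[of k] norm_triangle_ineq[of "grad f (x k + \<gamma> k *\<^sub>R v k) - g k" "g k"]
    by (simp add: algebra_simps)
  \<comment> \<open>If \<open>g k\<close> vanished, so would the gradient at the ex-point. This
    yields strict decrease of \<open>H\<close> and thereby positive energies.\<close>
  have g_pos: "0 < norm (g k)" if "1 \<le> k" for k
    using ex_le[of k] assms(18)[OF that] by (auto simp: ex)

  \<comment> \<open>The coefficients of the one-step descent estimate; the parameter condition says
    exactly \<open>0 < Q\<close> and \<open>R < P\<close>.\<close>
  define P Q R where "P = 1 - \<nu> - L * \<tau>\<^sub>1 * deltabar" and "Q = 1 - \<nu> - L * \<tau>\<^sub>1"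
    and "R = (L * \<tau>\<^sub>1 + 1) * betabar\<^sup>2 + L * \<tau>\<^sub>1 * deltabar"
  have Q: "0 < Q" and RP: "R < P" using assms(17) by (auto simp: P_def Q_def R_def)
  have R: "0 \<le> R" using assms(2,7) dd by (simp add: R_def)
  \<comment> \<open>The midpoint of \<open>R / (2 * \<tau>\<^sub>1)\<close> and
    \<open>P / (2 * \<tau>\<^sub>1)\<close>, leaving the surplus
    \<open>(P - R) / (4 * \<tau>\<^sub>1)\<close> for both the old and the new velocity.\<close>
  define c where "c = (P + R) / (4 * \<tau>\<^sub>1)"
  \<comment> \<open>The smallest surplus coefficient, divided by 3 for the square of the three-term
    sum \<open>s k\<close>.\<close>
  define \<sigma> where "\<sigma> = min ((P - R) / (4 * \<tau>\<^sub>1)) (Q * \<tau>\<^sub>1 / 2) / 3"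
  \<comment> \<open>\<open>betabar + deltabar\<close> bounds \<open>\<gamma> k\<close>, and 2 bounds
    \<open>1 + \<nu>\<close>.\<close>
  define C where "C = 2 + L * (betabar + deltabar)"
  define s where "s k = norm (v k) + norm (v (Suc k)) + norm (g k)" for k
  define H where "H k = f (x k) + c * (norm (v k))\<^sup>2" for k
  have c: "0 < c" using R RP assms(7) by (simp add: c_def)
  have \<sigma>: "0 < \<sigma>" using Q RP assms(7) by (simp add: \<sigma>_def)
  have C: "0 < C" using assms(2) bb dd by (simp add: C_def add_pos_nonneg)
  have s_pos: "0 < s k" if "1 \<le> k" for k
    using g_pos[OF that] by (simp add: s_def add_nonneg_pos)

  have H_step: "\<sigma> * (s k)\<^sup>2 \<le> H k - H (Suc k)" if k: "1 \<le> k" for k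
  proof -
    have "2 * \<tau>\<^sub>1 * (f (x (Suc k)) - f (x k)) + P * (norm (v (Suc k)))\<^sup>2 + Q * (\<tau>\<^sub>1 * norm (g k))\<^sup>2
        \<le> R * (norm (v k))\<^sup>2"
      unfolding P_def Q_def R_def v_Suc v_def[of k]
      using assms(2,5,7,14) step[OF k] err[of k] \<beta>_le[OF k] \<delta>_le[OF k] k
      by (intro inexact_momentum_step_descent[OF diff lip, where e = "\<gamma> k"]) (auto simp: v_def)
    then have "0 \<le> (R * (norm (v k))\<^sup>2 - (2 * \<tau>\<^sub>1 * (f (x (Suc k)) - f (x k)) + P * (norm (v (Suc k)))\<^sup>2
        + Q * (\<tau>\<^sub>1 * norm (g k))\<^sup>2)) / (2 * \<tau>\<^sub>1)"
      using assms(7) by simp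
    also have "\<dots> = H k - H (Suc k) - ((P - R) / (4 * \<tau>\<^sub>1) * (norm (v k))\<^sup>2
        + (P - R) / (4 * \<tau>\<^sub>1) * (norm (v (Suc k)))\<^sup>2 + Q * \<tau>\<^sub>1 / 2 * (norm (g k))\<^sup>2)"
      using assms(7) by (simp add: H_def c_def field_simps power2_eq_square)
    finally have "(P - R) / (4 * \<tau>\<^sub>1) * (norm (v k))\<^sup>2 + (P - R) / (4 * \<tau>\<^sub>1) * (norm (v (Suc k)))\<^sup>2
        + Q * \<tau>\<^sub>1 / 2 * (norm (g k))\<^sup>2 \<le> H k - H (Suc k)"
      by simp
    moreover have "3 * \<sigma> * (norm (v k))\<^sup>2 \<le> (P - R) / (4 * \<tau>\<^sub>1) * (norm (v k))\<^sup>2"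
      "3 * \<sigma> * (norm (v (Suc k)))\<^sup>2 \<le> (P - R) / (4 * \<tau>\<^sub>1) * (norm (v (Suc k)))\<^sup>2"
      "3 * \<sigma> * (norm (g k))\<^sup>2 \<le> Q * \<tau>\<^sub>1 / 2 * (norm (g k))\<^sup>2"
      by (intro mult_right_mono; simp add: \<sigma>_def)+
    moreover have "\<sigma> * (s k)\<^sup>2 \<le> \<sigma> * (3 * ((norm (v k))\<^sup>2 + (norm (v (Suc k)))\<^sup>2 + (norm (g k))\<^sup>2))"
      unfolding s_def using \<sigma> by (intro mult_left_mono sum3_squared_le) auto
    ultimately show ?thesis by (simp add: algebra_simps)
  qed
  have H_decr: "H (Suc k) < H k" if "1 \<le> k" for k
    using H_step[OF that] \<sigma> s_pos[OF that] by (smt (verit) mult_pos_pos zero_less_power)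

  obtain m where m: "m \<le> f (x k)" if "1 \<le> k" for k
    using assms(19) by (auto simp: bdd_below_def)
  have "decseq (\<lambda>n. H (Suc n))"
    using H_decr by (intro decseq_SucI) (simp add: less_imp_le)
  moreover have "m \<le> H (Suc n)" for n
    using m[of "Suc n"] c by (simp add: H_def add_increasing2)
  ultimately obtain h where "(\<lambda>n. H (Suc n)) \<longlonglongrightarrow> h" and h_le: "\<And>n. h \<le> H (Suc n)"
    using decseq_convergent[of "\<lambda>n. H (Suc n)" m] by auto
  then have H_lim: "H \<longlonglongrightarrow> h" by (simp add: filterlim_sequentially_Suc)
  have h_less: "h < H k" if "1 \<le> k" for k
    using H_decr[OF that] h_le[of k] by simp

  \<comment> \<open>Consecutive differences of the convergent \<open>H\<close> vanish in the limit
    and dominate \<open>(s k)\<^sup>2\<close>.\<close>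
  have "(\<lambda>k. (H k - H (Suc k)) / \<sigma>) \<longlonglongrightarrow> (h - h) / \<sigma>"
    using \<sigma> H_lim by (intro tendsto_intros) (auto simp: filterlim_sequentially_Suc)
  then have "(\<lambda>k. (H k - H (Suc k)) / \<sigma>) \<longlonglongrightarrow> 0" by simp
  then have "(\<lambda>k. (s k)\<^sup>2) \<longlonglongrightarrow> 0"
  proof (rule Lim_null_comparison[rotated])
    show "\<forall>\<^sub>F k in sequentially. norm ((s k)\<^sup>2) \<le> (H k - H (Suc k)) / \<sigma>"
      using H_step \<sigma> by (intro eventually_sequentiallyI[of 1]) (simp add: field_simps)
  qed
  then have s_lim: "s \<longlonglongrightarrow> 0" by simp
  have v_lim: "v \<longlonglongrightarrow> 0"
    by (rule Lim_null_comparison[OF _ s_lim]) (simp add: s_def)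
  have grad_le: "norm (grad f (x k)) \<le> C * s k" if k: "1 \<le> k" for k
  proof -
    have "norm (grad f (x k) - grad f (x k + \<gamma> k *\<^sub>R v k)) \<le> L * (\<gamma> k * norm (v k))"
      using lip[of "x k" "x k + \<gamma> k *\<^sub>R v k"] assms(6)[OF k] by simp
    also have "\<dots> \<le> L * ((betabar + deltabar) * norm (v k))"
      using \<beta>_le[OF k] \<delta>_le[OF k] assms(2) by (intro mult_left_mono mult_right_mono) auto
    finally have "norm (grad f (x k)) \<le> L * (betabar + deltabar) * norm (v k) + (1 + \<nu>) * norm (g k)"
      using ex_le[of k]
        norm_triangle_ineq[of "grad f (x k) - grad f (x k + \<gamma> k *\<^sub>R v k)" "grad f (x k + \<gamma> k *\<^sub>R v k)"]
      by simp
    also have "\<dots> \<le> L * (betabar + deltabar) * s k + 2 * s k"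
      using assms(2,14,15) bb dd by (intro add_mono mult_mono) (auto simp: s_def)
    finally show ?thesis by (simp add: C_def algebra_simps)
  qed
  have grad_lim: "(\<lambda>k. grad f (x k)) \<longlonglongrightarrow> 0"
  proof (rule Lim_null_comparison)
    show "\<forall>\<^sub>F k in sequentially. norm (grad f (x k)) \<le> C * s k"
      using grad_le by (intro eventually_sequentiallyI[of 1])
    show "(\<lambda>k. C * s k) \<longlonglongrightarrow> 0"
      using tendsto_mult_left[OF s_lim, of C] by simp
  qed
  \<comment> \<open>The velocities vanish, so the values share the limit of \<open>H\<close>. By
    continuity, \<open>f\<close> equals \<open>h\<close> at every accumulation point, which makes
    \<open>H k - f xbar\<close> a positive energy tending to 0.\<close>
  have f_lim: "(\<lambda>k. f (x k)) \<longlonglongrightarrow> h"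
  proof -
    have "(\<lambda>k. H k - c * (norm (v k))\<^sup>2) \<longlonglongrightarrow> h - c * (norm (0 :: real ^ 'n))\<^sup>2"
      using H_lim v_lim by (intro tendsto_intros)
    then show ?thesis by (simp add: H_def)
  qed

  have acc_value: "f xbar = h" "grad f xbar = 0" if "accumulation_point x xbar" for xbar
  proof -
    obtain r where r: "strict_mono r" "(x \<circ> r) \<longlonglongrightarrow> xbar"
      using \<open>accumulation_point x xbar\<close> by (auto simp: accumulation_point_def)
    have "(\<lambda>n. f ((x \<circ> r) n)) \<longlonglongrightarrow> f xbar"
      using continuous_on_tendsto_compose[OF f_cont r(2)] by simp
    then show "f xbar = h"
      using LIMSEQ_subseq_LIMSEQ[OF f_lim r(1)] by (simp add: o_def LIMSEQ_unique)
    have "(\<lambda>n. grad f ((x \<circ> r) n)) \<longlonglongrightarrow> grad f xbar"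
      using continuous_on_tendsto_compose[OF grad_cont r(2)] by simp
    then show "grad f xbar = 0"
      using LIMSEQ_subseq_LIMSEQ[OF grad_lim r(1)] by (simp add: o_def LIMSEQ_unique)
  qed
  have descent: "inertial_descent f x xbar (\<lambda>k. H k - f xbar) s c \<sigma> C"
    if acc: "accumulation_point x xbar" for xbar
  proof
    show "(\<lambda>k. H k - f xbar) \<longlonglongrightarrow> 0"
      using tendsto_diff[OF H_lim tendsto_const[of h]] by (simp add: acc_value[OF acc])
    show "norm (x k - x (k - 1)) \<le> s k" "norm (x (Suc k) - x k) \<le> s k" for k
      by (simp_all add: s_def v_def)
    show "H k - f xbar = f (x k) - f xbar + c * (norm (x k - x (k - 1)))\<^sup>2" for k
      by (simp add: H_def v_def)
  qed (use c \<sigma> C acc H_step h_less grad_le in \<open>auto simp: acc_value[OF acc]\<close>)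

  have "x \<longlonglongrightarrow> xbar \<and> stationary_point f xbar"
    if "accumulation_point x xbar" "basic_PLK f xbar" for xbar
    using inertial_descent.PLK_convergence[OF descent] acc_value that
    by (auto simp: basic_PLK_def stationary_point_def)
  moreover
  have "(q \<le> 1/2 \<longrightarrow>
          converges_linearly x xbar \<and>
          converges_linearly (\<lambda>k. grad f (x k)) 0 \<and>
          converges_linearly (\<lambda>k. f (x k)) (f xbar)) \<and>
       (1/2 < q \<longrightarrow>
          (\<lambda>k. norm (x k - xbar)) \<in> O(\<lambda>k. real k powr (- ((1 - q) / (2 * q - 1)))) \<and>
          (\<lambda>k. norm (grad f (x k))) \<in> O(\<lambda>k. real k powr (- ((1 - q) / (2 * q - 1)))) \<and>
          (\<lambda>k. f (x k) - f xbar) \<in> O(\<lambda>k. real k powr (- ((2 - 2 * q) / (2 * q - 1)))))"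
    if acc: "accumulation_point x xbar" and M: "M > 0" and q: "0 \<le> q" "q < 1"
      and plk: "PLK_with f xbar (\<lambda>t. M * t powr (1 - q))" for xbar M q
  proof (intro conjI impI)
    interpret inertial_descent f x xbar "\<lambda>k. H k - f xbar" s c \<sigma> C
      using acc by (rule descent)
    \<comment> \<open>As the gradient vanishes at \<open>xbar\<close>, gradients are linear and gaps
      quadratic in the distance, so the rates of the iterates determine the others.\<close>
    have grad_dist: "norm (grad f (x k)) \<le> L * norm (x k - xbar)" for k
      using lip[of "x k" xbar] acc_value[OF acc] by simp
    have f_dist: "\<bar>f (x k) - f xbar\<bar> \<le> L / 2 * (norm (x k - xbar))\<^sup>2" for k
      using descent_upper[OF diff lip, of "x k" xbar] descent_lower[OF diff lip, of xbar "x k"]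
      by (simp add: acc_value(2)[OF acc] abs_if)
    {
      assume "q \<le> 1 / 2"
      then show lin: "converges_linearly x xbar"
        by (rule linear_convergence[OF plk M q])
      then show "converges_linearly (\<lambda>k. grad f (x k)) 0"
        by (rule converges_linearly_mono[where B = L]) (simp add: grad_dist)
      \<comment> \<open>Within distance 1 the quadratic bound on the gap implies a linear
        one.\<close>
      have "\<forall>\<^sub>F k in sequentially. dist (x k) xbar < 1"
        using PLK_convergence[OF plk] by (intro tendstoD) auto
      then have "\<forall>\<^sub>F k in sequentially. norm (f (x k) - f xbar) \<le> L / 2 * norm (x k - xbar)"
      proof eventually_elim
        case (elim k)
        then have "L / 2 * (norm (x k - xbar))\<^sup>2 \<le> L / 2 * norm (x k - xbar)"
          using assms(2) by (intro mult_left_mono) (auto simp: power2_eq_square dist_norm mult_left_le)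
        with f_dist[of k] show ?case by simp
      qed
      with lin show "converges_linearly (\<lambda>k. f (x k)) (f xbar)"
        by (rule converges_linearly_mono)
    next
      assume q2: "1 / 2 < q"
      let ?e = "- ((1 - q) / (2 * q - 1))"
      show dist: "(\<lambda>k. norm (x k - xbar)) \<in> O(\<lambda>k. real k powr ?e)"
        by (rule sublinear_convergence[OF plk M q q2])
      have "(\<lambda>k. norm (grad f (x k))) \<in> O(\<lambda>k. norm (x k - xbar))"
        using grad_dist by (intro bigoI[of _ L]) simp
      then show "(\<lambda>k. norm (grad f (x k))) \<in> O(\<lambda>k. real k powr ?e)"
        using dist by (rule landau_o.big_trans)
      have "(\<lambda>k. f (x k) - f xbar) \<in> O(\<lambda>k. (norm (x k - xbar))\<^sup>2)"
        using f_dist by (intro bigoI[of _ "L / 2"]) simp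
      also have "(\<lambda>k. (norm (x k - xbar))\<^sup>2) \<in> O(\<lambda>k. (real k powr ?e)\<^sup>2)"
        using dist by (rule landau_o.big_power)
      also have "(\<lambda>k. (real k powr ?e)\<^sup>2) = (\<lambda>k. real k powr (- ((2 - 2 * q) / (2 * q - 1))))"
        by (simp add: power2_eq_square diff_divide_distrib flip: powr_add)
      finally show "(\<lambda>k. f (x k) - f xbar) \<in> O(\<lambda>k. real k powr (- ((2 - 2 * q) / (2 * q - 1))))" .
    }
  qed
  ultimately show ?thesis
    using grad_lim by blast
qed

end
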